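(* Let $p>2$ be a prime, let $\mathbb{K}$ be a cyclic number field of degree $p$ (that is, $\mathbb{K}/\mathbb{Q}$ is Galois with cyclic Galois group of order $p$), with ring of integers $\mathcal{O}_{\mathbb{K}}$, let $\theta$ be a generator of $\mathrm{Gal}(\mathbb{K}/\mathbb{Q})$, and let $\sigma:\mathbb{K}\to\mathbb{R}^p$ be the canonical embedding. Let $\mathcal{M}\subseteq\mathcal{O}_{\mathbb{K}}$ be a $\mathbb{Z}$-submodule such that $\theta(\mathcal{M})\subseteq\mathcal{M}$. Let $\alpha\in\mathcal{M}\setminus\mathbb{Z}$ be such that $\sigma(\alpha)$ is one of the shortest nonzero vectors in the lattice $\Lambda=\sigma(\mathcal{M})$. Then $Tr_{\mathbb{K}}(\alpha)\neq 0$ if and only if $B=\{\sigma(\alpha),\sigma(\theta(\alpha)),\ldots,\sigma(\theta^{p-1}(\alpha))\}$ generates (over $\mathbb{Z}$) a well-rounded sublattice of $\Lambda$ of rank $p$.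
   Context: The field $\mathbb{K}$ is totally real and is regarded as a subfield of $\mathbb{R}$. $Tr_{\mathbb{K}}(\alpha)=\sum_{i=0}^{p-1}\theta^i(\alpha)$ is the trace from $\mathbb{K}$ to $\mathbb{Q}$. The canonical embedding is $\sigma(x)=(x,\theta(x),\theta^2(x),\ldots,\theta^{p-1}(x))$ for $x\in\mathbb{K}$. A lattice in $\mathbb{R}^p$ is the $\mathbb{Z}$-span of a set of $\mathbb{R}$-linearly independent vectors; its rank is the number of these vectors. "Shortest" refers to the Euclidean norm: $\sigma(\alpha)\neq 0$ and $\|\sigma(\alpha)\|\leq\|v\|$ for all nonzero $v\in\Lambda$. A rank-$p$ lattice $L\subset\mathbb{R}^p$ is well-rounded if its set of minimal vectors $S(L)=\{v\in L: \|v\|^2=t_L\}$, where $t_L=\min\{\|v\|^2: 0\neq v\in L\}$, contains $p$ linearly independent vectors (equivalently, spans $\mathbb{R}^p$). *)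

theory Defs
  imports
    "HOL-Analysis.Analysis"
    "HOL-Computational_Algebra.Computational_Algebra"
    "HOL-Algebra.Elementary_Groups"
    "HOL-Algebra.Bij"
begin

definition is_subfield :: "real set \<Rightarrow> bool" where
  "is_subfield K \<longleftrightarrow> 0 \<in> K \<and> 1 \<in> K \<and>
     (\<forall>x\<in>K. \<forall>y\<in>K. x + y \<in> K \<and> x * y \<in> K) \<and>
     (\<forall>x\<in>K. - x \<in> K \<and> inverse x \<in> K)"

global_interpretation rat_space: vector_space "\<lambda>(q::rat) (x::real). of_rat q * x"
  by unfold_locales (simp_all add: algebra_simps of_rat_add of_rat_mult)

text \<open>
  The dimension function of the library returns 0 on infinite-dimensional spaces, so a
  positive degree means a finite extension.
\<close>

definition degree_over_rat :: "real set \<Rightarrow> nat" where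
  "degree_over_rat K = rat_space.dim K"

text \<open>
  Elements of the Galois group are extensional functions, that is, they take the value
  \<^term>\<open>undefined\<close> outside \<open>K\<close>, so that an automorphism of \<open>K\<close> is represented by exactly
  one function.
\<close>

definition rat_automorphisms :: "real set \<Rightarrow> (real \<Rightarrow> real) set" where
  "rat_automorphisms K = {f \<in> Bij K.
     (\<forall>x\<in>K. \<forall>y\<in>K. f (x + y) = f x + f y \<and> f (x * y) = f x * f y) \<and>
     (\<forall>q\<in>\<rat>. f q = q)}"

definition Gal :: "real set \<Rightarrow> (real \<Rightarrow> real) monoid" where
  "Gal K = BijGroup K \<lparr>carrier := rat_automorphisms K\<rparr>"

lemma subgroup_rat_automorphisms:
  assumes K: "is_subfield K" and Q: "\<rat> \<subseteq> K"
  shows "subgroup (rat_automorphisms K) (BijGroup K)"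
proof (rule group.subgroupI[OF group_BijGroup])
  show "rat_automorphisms K \<subseteq> carrier (BijGroup K)"
    by (auto simp: rat_automorphisms_def BijGroup_def)
  have "(\<lambda>x\<in>K. x) \<in> rat_automorphisms K"
    using K Q by (auto simp: rat_automorphisms_def id_Bij is_subfield_def)
  then show "rat_automorphisms K \<noteq> {}" by blast
next
  fix f assume f: "f \<in> rat_automorphisms K"
  then have B: "f \<in> Bij K" by (simp add: rat_automorphisms_def)
  then have bij: "bij_betw f K K" by (simp add: Bij_def)
  define g where "g = inv_into K f"
  have fg: "f (g x) = x" "g x \<in> K" if "x \<in> K" for x
    using bij that by (auto simp: g_def bij_betw_def f_inv_into_f inv_into_into)
  have gf: "g (f x) = x" if "x \<in> K" for x
    using bij that by (auto simp: g_def bij_betw_def)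
  have add: "g (x + y) = g x + g y" and mult: "g (x * y) = g x * g y"
    if xy: "x \<in> K" "y \<in> K" for x y
  proof -
    have m: "g x + g y \<in> K" "g x * g y \<in> K"
      using K xy fg by (auto simp: is_subfield_def)
    have "f (g x + g y) = x + y" "f (g x * g y) = x * y"
      using f xy fg by (auto simp: rat_automorphisms_def)
    then show "g (x + y) = g x + g y" "g (x * y) = g x * g y"
      using gf m by metis+
  qed
  have fixq: "g q = q" if "q \<in> \<rat>" for q
    using f that Q gf[of q] by (auto simp: rat_automorphisms_def)
  have "inv\<^bsub>BijGroup K\<^esub> f = restrict g K"
    using inv_BijGroup[OF B] by (simp add: g_def)
  moreover have "restrict g K \<in> rat_automorphisms K"
    using restrict_inv_into_Bij[OF B] K Q add mult fixq
    by (auto simp: rat_automorphisms_def g_def is_subfield_def)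
  ultimately show "inv\<^bsub>BijGroup K\<^esub> f \<in> rat_automorphisms K" by simp
next
  fix f g assume fg: "f \<in> rat_automorphisms K" "g \<in> rat_automorphisms K"
  then have B: "f \<in> Bij K" "g \<in> Bij K" by (auto simp: rat_automorphisms_def)
  then have "f \<otimes>\<^bsub>BijGroup K\<^esub> g = compose K f g" by (simp add: BijGroup_def)
  moreover have "compose K f g \<in> rat_automorphisms K"
    using fg compose_Bij[OF B] K Q Bij_imp_funcset[OF B(2)]
    by (auto simp: rat_automorphisms_def compose_def is_subfield_def Pi_iff subset_iff)
  ultimately show "f \<otimes>\<^bsub>BijGroup K\<^esub> g \<in> rat_automorphisms K" by simp
qed

lemma group_Gal: "is_subfield K \<Longrightarrow> \<rat> \<subseteq> K \<Longrightarrow> group (Gal K)"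
  unfolding Gal_def
  by (intro subgroup.subgroup_is_group subgroup_rat_automorphisms group_BijGroup)

definition galois_over_rat :: "real set \<Rightarrow> bool" where
  "galois_over_rat K \<longleftrightarrow> (\<forall>x\<in>K. algebraic x) \<and>
     {x \<in> K. \<forall>f\<in>carrier (Gal K). f x = x} = \<rat>"

text \<open>
  No separate condition expresses that the field is totally real: a Galois extension of the
  rationals that is contained in \<^typ>\<open>real\<close> has only real embeddings.
\<close>

definition cyclic_number_field :: "nat \<Rightarrow> real set \<Rightarrow> bool" where
  "cyclic_number_field n K \<longleftrightarrow> is_subfield K \<and> degree_over_rat K = n \<and>
     galois_over_rat K \<and> cyclic_group (Gal K) \<and> order (Gal K) = n"

definition ring_of_integers :: "real set \<Rightarrow> real set" where
  "ring_of_integers K = {x \<in> K. algebraic_int x}"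

definition Tr :: "nat \<Rightarrow> (real \<Rightarrow> real) \<Rightarrow> real \<Rightarrow> real" where
  "Tr n \<theta> x = (\<Sum>i<n. (\<theta> ^^ i) x)"

text \<open>
  The coordinates of \<^typ>\<open>real ^ 'n\<close> are numbered \<open>0, 1, \<dots>\<close> along the order of \<^typ>\<open>'n\<close>:
  the number of a coordinate is the number of its predecessors.
\<close>

definition canonical_embedding ::
    "(real \<Rightarrow> real) \<Rightarrow> real \<Rightarrow> real ^ 'n::{finite,linorder}" where
  "canonical_embedding \<theta> x = (\<chi> j. (\<theta> ^^ card {..<j}) x)"

global_interpretation int_module: module
    "\<lambda>(k::int) (x::'a::real_vector). of_int k *\<^sub>R x"
  by unfold_locales (simp_all add: algebra_simps)

definition int_submodule :: "'a::real_vector set \<Rightarrow> bool" where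
  "int_submodule M \<longleftrightarrow> int_module.subspace M"

definition int_span :: "'a::real_vector set \<Rightarrow> 'a set" where
  "int_span B = int_module.span B"

definition lattice_of_rank :: "nat \<Rightarrow> 'a::euclidean_space set \<Rightarrow> bool" where
  "lattice_of_rank r L \<longleftrightarrow> (\<exists>B. independent B \<and> card B = r \<and> L = int_span B)"

definition sq_minimum :: "'a::euclidean_space set \<Rightarrow> real" where
  "sq_minimum L = (LEAST t. \<exists>v\<in>L. v \<noteq> 0 \<and> t = (norm v)\<^sup>2)"

definition minimal_vectors :: "'a::euclidean_space set \<Rightarrow> 'a set" where
  "minimal_vectors L = {v \<in> L. (norm v)\<^sup>2 = sq_minimum L}"

definition well_rounded :: "'a::euclidean_space set \<Rightarrow> bool" where
  "well_rounded L \<longleftrightarrow> lattice_of_rank DIM('a) L \<and>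
     (\<exists>S \<subseteq> minimal_vectors L. independent S \<and> card S = DIM('a))"

definition shortest_nonzero_in :: "'a::euclidean_space \<Rightarrow> 'a set \<Rightarrow> bool" where
  "shortest_nonzero_in u L \<longleftrightarrow> u \<in> L \<and> u \<noteq> 0 \<and> (\<forall>v\<in>L. v \<noteq> 0 \<longrightarrow> norm u \<le> norm v)"

end

theory Submission
  imports Defs "HOL-Algebra.Multiplicative_Group"
begin

text \<open>
  If the trace of \<open>\<alpha>\<close> vanishes, the conjugate vectors sum to zero and span a space of dimension
  less than \<open>p\<close>. Conversely, suppose that the trace is nonzero. Taking the trace of an integral
  relation \<open>f(\<theta>) \<alpha> = 0\<close> gives \<open>f(1) = 0\<close>, so \<open>f = (x - 1) f'\<close> and \<open>f'(\<theta>) \<beta> = 0\<close> with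
  \<open>\<beta> = \<theta> \<alpha> - \<alpha> \<noteq> 0\<close>. In the variable \<open>Y = x - 1\<close> the annihilator of \<open>\<beta>\<close> contains the Eisenstein
  polynomial \<open>((1 + Y)^p - 1) / Y\<close>; a nonzero annihilating polynomial of degree less than \<open>p - 1\<close>
  would make \<open>\<beta>\<close> divisible by every power of \<open>p\<close> in \<open>M\<close>, which is impossible because \<open>\<sigma> ` M\<close> has
  a shortest vector. So the conjugates of \<open>\<alpha>\<close> form a rational basis of \<open>K\<close>, and a real linear
  relation between their images under \<open>\<sigma>\<close> is a relation between the automorphisms \<open>\<theta> ^^ i\<close>,
  excluded by Dedekind's independence of characters. Since \<open>\<sigma> (\<theta> x)\<close> is a cyclic shift of \<open>\<sigma> x\<close>,
  the images are then independent minimal vectors.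
\<close>

hide_const (open) up_ring.coeff up_ring.monom Module.smult

no_notation fps_nth (infixl "$" 75)

section \<open>Eisenstein polynomials in ideals of integer polynomials\<close>

text \<open>Multiplication by a power of \<open>Y\<close> moves the lowest coefficient prime to \<open>p\<close> of a nonzero element
  to degree \<open>n - 1\<close>, so \<open>Y ^ (n - 1)\<close> is a multiple of \<open>p\<close> modulo \<open>I\<close>. Comparison with the Eisenstein
  polynomial shows that \<open>Y\<close> is a unit modulo \<open>I\<close>; but \<open>Y ^ n\<close> is a multiple of \<open>p\<close>.\<close>

lemma eisenstein_ideal:
  fixes I :: "int poly set" and p n :: nat and f h :: "int poly"
  assumes p: "prime p"
    and add: "\<And>f g. f \<in> I \<Longrightarrow> g \<in> I \<Longrightarrow> f + g \<in> I"
    and mult: "\<And>f g. f \<in> I \<Longrightarrow> g * f \<in> I"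
    and saturated: "\<And>c f. c \<noteq> 0 \<Longrightarrow> smult c f \<in> I \<Longrightarrow> f \<in> I"
    and no_unit: "\<And>w. 1 - smult (int p) w \<notin> I"
    and E: "[:0, 1:] ^ n + smult (int p) (1 + [:0, 1:] * h) \<in> I"
    and f: "f \<in> I" "degree f < n"
  shows "f = 0"
proof (rule ccontr)
  assume "f \<noteq> 0"
  define Y where "Y = [:0, 1 :: int:]"
  define P where "P = [:int p:]"
  define g where "g = primitive_part f"
  have smult_P: "smult (int p) q = P * q" for q
    by (simp add: P_def)
  have diff: "a - b \<in> I" if "a \<in> I" "b \<in> I" for a b
    using add[OF that(1) mult[OF that(2), of "- 1"]] by simp
  have E': "Y ^ n + P * (1 + Y * h) \<in> I"
    using E by (simp only: smult_P flip: Y_def)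
  \<comment> \<open>Saturation removes the content, leaving a primitive element of \<open>I\<close>,
    which has a coefficient prime to \<open>p\<close>.\<close>
  have "content f \<noteq> 0"
    using \<open>f \<noteq> 0\<close> by simp
  then have g: "g \<in> I"
    using saturated[of "content f" g] f(1) by (simp add: g_def)
  have "\<not> int p dvd content g"
    using \<open>f \<noteq> 0\<close> p by (auto simp: g_def)
  then have "\<exists>k. \<not> int p dvd coeff g k"
    by (metis const_poly_dvd_iff const_poly_dvd_iff_dvd_content)
  then obtain k where k: "\<not> int p dvd coeff g k" "\<And>i. i < k \<Longrightarrow> int p dvd coeff g i"
    using exists_least_iff[of "\<lambda>k. \<not> int p dvd coeff g k"] by blast
  define d where "d = coeff g k"
  define D where "D = [:d:]"
  define b where "b = poly_shift (Suc k) g"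
  have "k \<le> degree g"
    using k(1) by (metis dvd_0_right le_degree)
  then have "k < n"
    using f(2) by (simp add: g_def)
  have "P dvd poly_cutoff k g"
    unfolding P_def const_poly_dvd_iff using k(2) by (simp add: coeff_poly_cutoff)
  then obtain a where a: "poly_cutoff k g = P * a" ..
  have "Y ^ k = monom 1 k"
    by (simp add: Y_def monom_altdef)
  moreover have "pCons d b = poly_shift k g"
    by (rule poly_eqI) (simp add: d_def b_def coeff_poly_shift coeff_pCons split: nat.split)
  ultimately have "g = poly_cutoff k g + Y ^ k * pCons d b"
    by (intro poly_eqI) (simp add: coeff_monom_mult coeff_poly_cutoff coeff_poly_shift)
  also have "pCons d b = D + Y * b"
    by (simp add: Y_def D_def)
  finally have g_eq: "g = P * a + Y ^ k * (D + Y * b)"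
    by (simp only: a)
  \<comment> \<open>After the shift by \<open>m\<close> the coefficient \<open>d\<close> sits in
    degree \<open>n - 1\<close>; the part before it is a multiple of \<open>P\<close>, the part
    after it a multiple of \<open>Y ^ n\<close>.\<close>
  define m where "m = n - 1 - k"
  have "Y ^ m * g \<in> I"
    by (rule mult[OF g])
  moreover have Y: "Y ^ m * Y ^ k = Y ^ (n - 1)" "Y ^ (n - 1) * Y = Y ^ n"
    using \<open>k < n\<close> by (simp_all add: m_def power_add[symmetric] power_Suc2[symmetric])
  have "Y ^ m * g = P * (Y ^ m * a) + D * (Y ^ m * Y ^ k) + b * ((Y ^ m * Y ^ k) * Y)"
    unfolding g_eq by (simp only: algebra_simps)
  ultimately have "P * (Y ^ m * a) + D * Y ^ (n - 1) + b * Y ^ n \<in> I"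
    unfolding Y by simp
  from diff[OF this mult[OF E', of b]]
  have 1: "D * Y ^ (n - 1) + P * (Y ^ m * a - b * (1 + Y * h)) \<in> I"
    by (simp add: algebra_simps)
  \<comment> \<open>Bezout inverts \<open>d\<close> modulo \<open>p\<close>, which turns
    \<open>D * Y ^ (n - 1)\<close> into \<open>Y ^ (n - 1)\<close> up to multiples of
    \<open>P\<close>.\<close>
  have "coprime d (int p)"
    using p k(1) by (simp add: d_def prime_imp_coprime coprime_commute)
  then obtain e q where "e * d + q * int p = 1"
    by (metis bezout_int coprime_imp_gcd_eq_1)
  then have "[:e:] * D = 1 - P * [:q:]"
    by (simp add: P_def D_def one_pCons mult.commute)
  then obtain e' q' where eq: "e' * D = 1 - P * q'"
    by blast
  have "e' * (D * Y ^ (n - 1) + P * t) = e' * D * Y ^ (n - 1) + P * (e' * t)" for t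
    by (simp add: algebra_simps)
  also have "e' * D * Y ^ (n - 1) + P * (e' * t) = Y ^ (n - 1) + P * (e' * t - q' * Y ^ (n - 1))" for t
    unfolding eq by (simp add: algebra_simps)
  finally obtain s where s: "Y ^ (n - 1) + P * s \<in> I"
    using mult[OF 1, of e'] by metis
  \<comment> \<open>Subtracting \<open>Y\<close> times the relation with \<open>s\<close> from the
    Eisenstein polynomial cancels \<open>Y ^ n\<close> and leaves a factor \<open>P\<close>, which
    saturation removes; so \<open>- r\<close> inverts \<open>Y\<close> modulo
    \<open>I\<close>.\<close>
  define r where "r = h - s"
  have eq: "(Y ^ n + P * (1 + Y * h)) - Y * (Y ^ (n - 1) + P * s) = P * (1 + Y * r)"
    unfolding Y(2)[symmetric] by (simp add: r_def algebra_simps)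
  have "P * (1 + Y * r) \<in> I"
    using diff[OF E' mult[OF s, of Y]] unfolding eq .
  then have "smult (int p) (1 + Y * r) \<in> I"
    by (subst smult_P)
  then have r: "1 + Y * r \<in> I"
    using prime_gt_0_nat[OF p] by (intro saturated[of "int p" "1 + Y * r"]) simp_all
  \<comment> \<open>\<open>1 - z ^ n\<close> is a multiple of \<open>1 - z\<close> for
    \<open>z = - (Y * r)\<close>. Replacing \<open>Y ^ n\<close> by a multiple of \<open>P\<close>
    then gives an element excluded by \<open>no_unit\<close>.\<close>
  have "1 - (- (Y * r)) ^ n \<in> I"
    unfolding one_diff_power_eq minus_minus diff_minus_eq_add by (subst mult.commute) (rule mult[OF r])
  moreover have "1 - (- (Y * r)) ^ n + (- r) ^ n * (Y ^ n + P * (1 + Y * h)) =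
      1 - P * (- ((- r) ^ n * (1 + Y * h)))"
  proof -
    have "(- (Y * r)) ^ n = (- r) ^ n * Y ^ n"
      by (metis mult.commute mult_minus_right power_mult_distrib)
    then show ?thesis
      by (simp add: algebra_simps)
  qed
  ultimately have "1 - smult (int p) (- ((- r) ^ n * (1 + Y * h))) \<in> I"
    using add mult[OF E', of "(- r) ^ n"] by (metis smult_P)
  then show False
    using no_unit by blast
qed

text \<open>The inner binomial coefficients are divisible by \<open>p\<close>, and the linear one is
  exactly \<open>p\<close>. The cofactor of \<open>Y\<close> is the \<open>p\<close>-th cyclotomic
  polynomial in \<open>1 + Y\<close>.\<close>

lemma one_plus_Y_power_prime_eq_eisenstein:
  fixes p :: nat
  assumes p: "prime p"
  obtains h :: "int poly" where
    "[:0, 1:] * ([:0, 1:] ^ (p - 1) + smult (int p) (1 + [:0, 1:] * h)) = [:1, 1:] ^ p - 1"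
proof -
  define Y where "Y = [:0, 1 :: int:]"
  have "p \<ge> 2"
    using p by (rule prime_ge_2_nat)
  \<comment> \<open>The division by \<open>p\<close> is exact. The exponent drops by 2: one
    \<open>Y\<close> is factored out of the whole, another inside \<open>1 + Y * h\<close>.\<close>
  define h where "h = (\<Sum>k\<in>{2..<p}. of_nat ((p choose k) div p) * Y ^ (k - 2))"
  have "[:1, 1:] ^ p = (Y + 1) ^ p"
    by (simp add: Y_def one_pCons)
  also have "\<dots> = (\<Sum>k\<le>p. of_nat (p choose k) * Y ^ k)"
    by (simp add: binomial_ring)
  also have "{..p} = insert 0 (insert 1 (insert p {2..<p}))"
    using \<open>p \<ge> 2\<close> by auto
  also have "(\<Sum>k\<in>\<dots>. of_nat (p choose k) * Y ^ k) =
      1 + (of_nat p * Y + (Y ^ p + (\<Sum>k\<in>{2..<p}. of_nat (p choose k) * Y ^ k)))"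
    using \<open>p \<ge> 2\<close> by simp
  also have "(\<Sum>k\<in>{2..<p}. of_nat (p choose k) * Y ^ k) = Y * (of_nat p * (Y * h))"
    unfolding h_def sum_distrib_left
  proof (intro sum.cong refl)
    fix k assume k: "k \<in> {2..<p}"
    then have "p dvd (p choose k)"
      using p by (intro dvd_choose_prime) auto
    then have "(of_nat (p choose k) :: int poly) = of_nat p * of_nat ((p choose k) div p)"
      by (metis dvd_mult_div_cancel of_nat_mult)
    moreover have "Y ^ k = Y * (Y * Y ^ (k - 2))"
      using k by (metis atLeastLessThan_iff le_add_diff_inverse2 add_2_eq_Suc' power_Suc)
    ultimately show "of_nat (p choose k) * Y ^ k =
        Y * (of_nat p * (Y * (of_nat ((p choose k) div p) * Y ^ (k - 2))))"
      by (simp add: mult.assoc mult.left_commute)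
  qed
  also have "Y ^ p = Y * Y ^ (p - 1)"
    using \<open>p \<ge> 2\<close> by (simp flip: power_Suc)
  finally have "[:1, 1:] ^ p - 1 = Y * (Y ^ (p - 1) + of_nat p * (1 + Y * h))"
    by (simp add: algebra_simps)
  moreover have "of_nat p * q = smult (int p) q" for q :: "int poly"
    by (simp add: of_nat_poly)
  ultimately show ?thesis
    using that[of h] by (simp add: Y_def)
qed

section \<open>Relations between conjugates\<close>

lemma pcompose_power: "pcompose (p ^ n) q = pcompose p q ^ n"
  for p q :: "'a::comm_semiring_1 poly"
  by (induction n) (simp_all add: pcompose_1 pcompose_mult)

text \<open>Evaluation of \<open>f\<close> at the operator \<theta>; integer coefficients keep
  \<theta>-stable submodules stable.\<close>

definition conj_act :: "(real \<Rightarrow> real) \<Rightarrow> int poly \<Rightarrow> real \<Rightarrow> real" where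
  "conj_act \<theta> f x = (\<Sum>i\<le>degree f. of_int (coeff f i) * (\<theta> ^^ i) x)"

lemma conj_act_eq_sum:
  assumes "degree f < n"
  shows "conj_act \<theta> f x = (\<Sum>i<n. of_int (coeff f i) * (\<theta> ^^ i) x)"
  unfolding conj_act_def
  by (rule sum.mono_neutral_left) (use assms in \<open>auto simp: coeff_eq_0\<close>)

lemma conj_act_0 [simp]: "conj_act \<theta> 0 x = 0"
  by (simp add: conj_act_def)

lemma conj_act_1 [simp]: "conj_act \<theta> 1 x = x"
  by (simp add: conj_act_def)

lemma conj_act_pCons: "conj_act \<theta> (pCons c f) x = of_int c * x + conj_act \<theta> f (\<theta> x)"
proof -
  have "degree (pCons c f) < Suc (Suc (degree f))"
    using degree_pCons_le[of c f] by linarith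
  then have "conj_act \<theta> (pCons c f) x =
      (\<Sum>i<Suc (Suc (degree f)). of_int (coeff (pCons c f) i) * (\<theta> ^^ i) x)"
    by (rule conj_act_eq_sum)
  also have "\<dots> = of_int c * x + conj_act \<theta> f (\<theta> x)"
    by (subst sum.lessThan_Suc_shift)
      (simp add: conj_act_eq_sum[of f "Suc (degree f)"] funpow_Suc_right del: funpow.simps)
  finally show ?thesis .
qed

lemma conj_act_add: "conj_act \<theta> (f + g) x = conj_act \<theta> f x + conj_act \<theta> g x"
  by (induction f g arbitrary: x rule: poly_induct2) (simp_all add: conj_act_pCons algebra_simps)

lemma conj_act_diff: "conj_act \<theta> (f - g) x = conj_act \<theta> f x - conj_act \<theta> g x"
  by (induction f g arbitrary: x rule: poly_induct2) (simp_all add: conj_act_pCons algebra_simps)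

lemma conj_act_smult: "conj_act \<theta> (smult c f) x = of_int c * conj_act \<theta> f x"
  by (induction f arbitrary: x) (simp_all add: conj_act_pCons algebra_simps)

lemma int_submodule_iff:
  "int_submodule (M :: 'a::real_vector set) \<longleftrightarrow>
    0 \<in> M \<and> (\<forall>x\<in>M. \<forall>y\<in>M. x + y \<in> M) \<and> (\<forall>k. \<forall>x\<in>M. of_int k *\<^sub>R x \<in> M)"
  unfolding int_submodule_def int_module.subspace_def by blast

lemma conj_act_in_submodule:
  assumes "int_submodule M" "\<theta> ` M \<subseteq> M" "x \<in> M"
  shows "conj_act \<theta> f x \<in> M"
  using \<open>x \<in> M\<close>
proof (induction f arbitrary: x)
  case 0
  then show ?case
    using assms(1) by (simp add: int_submodule_iff)
next
  case (pCons c f)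
  then have "conj_act \<theta> f (\<theta> x) \<in> M"
    using assms by blast
  then show ?case
    using assms(1) pCons.prems by (simp add: conj_act_pCons int_submodule_iff)
qed

text \<open>The product of the denominators works; it turns rational relations between conjugates
  into integral ones.\<close>

lemma common_denominator:
  fixes c :: "'a \<Rightarrow> rat"
  assumes "finite A"
  shows "\<exists>D::int. D > 0 \<and> (\<forall>a\<in>A. of_int D * c a \<in> \<int>)"
  using assms
proof (induction A rule: finite_induct)
  case empty
  show ?case by (rule exI[of _ 1]) simp
next
  case (insert b A)
  then obtain D :: int where D: "D > 0" "\<forall>a\<in>A. of_int D * c a \<in> \<int>"
    by blast
  obtain m n where mn: "quotient_of (c b) = (m, n)"
    by fastforce
  then have n: "n > 0" and cb: "c b = of_int m / of_int n"
    by (simp_all add: quotient_of_denom_pos quotient_of_div)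
  have "of_int (n * D) * c a \<in> \<int>" if "a \<in> insert b A" for a
  proof (cases "a = b")
    case True
    have "of_int (n * D) * c b = of_int (D * m)"
      using n by (simp add: cb)
    then show ?thesis
      using True by (metis Ints_of_int)
  next
    case False
    then have "of_int D * c a \<in> \<int>"
      using that D by blast
    then have "of_int n * (of_int D * c a) \<in> \<int>"
      by (rule Ints_mult[OF Ints_of_int])
    then show ?thesis
      by (simp only: of_int_mult mult.assoc)
  qed
  then show ?case
    using D(1) n by (intro exI[of _ "n * D"]) auto
qed

text \<open>Dedekind's argument: \<open>\<psi> j y\<close> times the relation at \<open>x\<close> is subtracted from the
  relation at \<open>x * y\<close>, which removes \<open>\<psi> j\<close>.\<close>

lemma characters_independent:
  fixes \<psi> :: "'i \<Rightarrow> 'a::monoid_mult \<Rightarrow> 'b::idom"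
  assumes "finite I"
    and K: "1 \<in> K" "\<And>x y. x \<in> K \<Longrightarrow> y \<in> K \<Longrightarrow> x * y \<in> K"
    and mult: "\<And>i x y. i \<in> I \<Longrightarrow> x \<in> K \<Longrightarrow> y \<in> K \<Longrightarrow> \<psi> i (x * y) = \<psi> i x * \<psi> i y"
    and one: "\<And>i. i \<in> I \<Longrightarrow> \<psi> i 1 = 1"
    and distinct: "\<And>i j. i \<in> I \<Longrightarrow> j \<in> I \<Longrightarrow> i \<noteq> j \<Longrightarrow> \<exists>x\<in>K. \<psi> i x \<noteq> \<psi> j x"
    and rel: "\<And>x. x \<in> K \<Longrightarrow> (\<Sum>i\<in>I. c i * \<psi> i x) = 0"
    and "i \<in> I"
  shows "c i = 0"
  using assms(1) mult one distinct rel \<open>i \<in> I\<close>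
proof (induction I arbitrary: c i rule: finite_induct)
  case empty
  then show ?case by simp
next
  case (insert j I)
  have c: "c k = 0" if k: "k \<in> I" for k
  proof -
    from k insert.hyps insert.prems(3)[of k j] obtain y where y: "y \<in> K" "\<psi> k y \<noteq> \<psi> j y"
      by blast
    have "(\<Sum>i\<in>I. (c i * (\<psi> i y - \<psi> j y)) * \<psi> i x) = 0" if x: "x \<in> K" for x
    proof -
      have "(\<Sum>i\<in>insert j I. c i * \<psi> i (x * y)) - \<psi> j y * (\<Sum>i\<in>insert j I. c i * \<psi> i x) = 0"
        using insert.prems(4)[OF x] insert.prems(4)[OF K(2)[OF x y(1)]] by simp
      moreover have "(\<Sum>i\<in>insert j I. c i * \<psi> i (x * y)) =
          (\<Sum>i\<in>insert j I. c i * (\<psi> i x * \<psi> i y))"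
        using insert.prems(1) x y by simp
      ultimately have "(\<Sum>i\<in>insert j I. (c i * (\<psi> i y - \<psi> j y)) * \<psi> i x) = 0"
        by (simp add: sum_distrib_left sum_subtractf algebra_simps)
      then show ?thesis
        using insert.hyps by simp
    qed
    then have "c k * (\<psi> k y - \<psi> j y) = 0"
      by (intro insert.IH[of "\<lambda>i. c i * (\<psi> i y - \<psi> j y)"]) (use insert.prems k in auto)
    then show ?thesis
      using y by simp
  qed
  \<comment> \<open>With all other coefficients zero, evaluation at 1 leaves
    \<open>c j\<close>.\<close>
  moreover have "c j = 0"
    using insert.prems(4)[OF K(1)] insert.hyps insert.prems(2)[of j] c by simp
  ultimately show ?case
    using insert.prems(5) by auto
qed

text \<open>What the argument uses of a generator of the Galois group, expressed by iterates of a
  function on \<open>K\<close> instead of group operations.\<close>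

locale cyclic_automorphism =
  fixes p :: nat and K :: "real set" and \<theta> :: "real \<Rightarrow> real"
  assumes prime: "prime p"
    and subfield: "is_subfield K"
    and rat_subset: "\<rat> \<subseteq> K"
    and closed: "x \<in> K \<Longrightarrow> \<theta> x \<in> K"
    and add: "x \<in> K \<Longrightarrow> y \<in> K \<Longrightarrow> \<theta> (x + y) = \<theta> x + \<theta> y"
    and mult: "x \<in> K \<Longrightarrow> y \<in> K \<Longrightarrow> \<theta> (x * y) = \<theta> x * \<theta> y"
    and rat: "q \<in> \<rat> \<Longrightarrow> \<theta> q = q"
    and period: "x \<in> K \<Longrightarrow> (\<theta> ^^ p) x = x"
    and distinct: "i < p \<Longrightarrow> j < p \<Longrightarrow> i \<noteq> j \<Longrightarrow> \<exists>x\<in>K. (\<theta> ^^ i) x \<noteq> (\<theta> ^^ j) x"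
    and fixed: "x \<in> K \<Longrightarrow> \<theta> x = x \<Longrightarrow> x \<in> \<rat>"
begin

lemma K_add: "x \<in> K \<Longrightarrow> y \<in> K \<Longrightarrow> x + y \<in> K"
  and K_mult: "x \<in> K \<Longrightarrow> y \<in> K \<Longrightarrow> x * y \<in> K"
  and K_0: "0 \<in> K" and K_1: "1 \<in> K"
  and K_of_int: "of_int k \<in> K"
  and K_of_rat: "of_rat q \<in> K"
  using subfield rat_subset by (auto simp: is_subfield_def)

lemma int_linear: "x \<in> K \<Longrightarrow> \<theta> (of_int k * x) = of_int k * \<theta> x"
  by (simp add: mult K_of_int rat)

lemma funpow_closed: "x \<in> K \<Longrightarrow> (\<theta> ^^ i) x \<in> K"
  by (induction i) (simp_all add: closed)

lemma funpow_conj_add: "x \<in> K \<Longrightarrow> y \<in> K \<Longrightarrow> (\<theta> ^^ i) (x + y) = (\<theta> ^^ i) x + (\<theta> ^^ i) y"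
  by (induction i) (simp_all add: add funpow_closed)

lemma funpow_conj_mult: "x \<in> K \<Longrightarrow> y \<in> K \<Longrightarrow> (\<theta> ^^ i) (x * y) = (\<theta> ^^ i) x * (\<theta> ^^ i) y"
  by (induction i) (simp_all add: mult funpow_closed)

lemma funpow_rat: "q \<in> \<rat> \<Longrightarrow> (\<theta> ^^ i) q = q"
  by (induction i) (simp_all add: rat)

lemma conj_act_closed: "x \<in> K \<Longrightarrow> conj_act \<theta> f x \<in> K"
  by (induction f arbitrary: x) (simp_all add: K_0 conj_act_pCons K_add K_mult K_of_int closed)

text \<open>Since \<theta> fixes the integer coefficients, polynomials in \<theta> commute with
  \<theta>; hence products of polynomials act by composition.\<close>

lemma conj_act_conj: "x \<in> K \<Longrightarrow> conj_act \<theta> f (\<theta> x) = \<theta> (conj_act \<theta> f x)"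
  by (induction f arbitrary: x)
    (simp_all add: rat conj_act_pCons add int_linear K_mult K_of_int closed conj_act_closed)

lemma conj_act_mult: "x \<in> K \<Longrightarrow> conj_act \<theta> (f * g) x = conj_act \<theta> f (conj_act \<theta> g x)"
  by (induction f arbitrary: x)
    (simp_all add: conj_act_pCons conj_act_add conj_act_smult conj_act_conj
      conj_act_closed closed)

lemma conj_act_Y_power: "conj_act \<theta> ([:0, 1:] ^ i) x = (\<theta> ^^ i) x"
  by (induction i arbitrary: x) (simp_all add: conj_act_pCons funpow_Suc_right del: funpow.simps)

text \<open>By periodicity \<theta> permutes the summands cyclically. The function \<open>g\<close>
  is the identity for traces and the square for norms.\<close>

lemma sum_conj_shift:
  fixes g :: "real \<Rightarrow> 'a::ab_group_add"
  assumes "x \<in> K"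
  shows "(\<Sum>i<p. g ((\<theta> ^^ i) (\<theta> x))) = (\<Sum>i<p. g ((\<theta> ^^ i) x))"
proof -
  have "g x + (\<Sum>i<p. g ((\<theta> ^^ i) (\<theta> x))) = (\<Sum>i<Suc p. g ((\<theta> ^^ i) x))"
    by (subst sum.lessThan_Suc_shift) (simp add: funpow_Suc_right del: funpow.simps)
  also have "\<dots> = (\<Sum>i<p. g ((\<theta> ^^ i) x)) + g x"
    by (simp add: period assms)
  finally show ?thesis
    by simp
qed

lemma Tr_conj: "x \<in> K \<Longrightarrow> Tr p \<theta> (\<theta> x) = Tr p \<theta> x"
  unfolding Tr_def by (rule sum_conj_shift[where g = "\<lambda>y. y"])

text \<open>The trace does not see \<theta>, so the indeterminate may be replaced by 1.\<close>

lemma Tr_conj_act: "x \<in> K \<Longrightarrow> Tr p \<theta> (conj_act \<theta> f x) = of_int (poly f 1) * Tr p \<theta> x"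
proof (induction f arbitrary: x)
  case 0
  then show ?case
    by (simp add: Tr_def funpow_rat)
next
  case (pCons c f)
  have "Tr p \<theta> (conj_act \<theta> (pCons c f) x) = of_int c * Tr p \<theta> x + Tr p \<theta> (conj_act \<theta> f (\<theta> x))"
    using pCons.prems
    by (simp add: Tr_def conj_act_pCons funpow_conj_add funpow_conj_mult funpow_rat K_mult K_of_int
        conj_act_closed closed sum.distrib sum_distrib_left)
  also have "\<dots> = of_int (poly (pCons c f) 1) * Tr p \<theta> x"
    using pCons by (simp add: closed Tr_conj algebra_simps)
  finally show ?case .
qed

text \<open>Passing to \<beta> lowers the degree of the relation below \<open>p - 1\<close>, the
  degree of the Eisenstein polynomial. The hypothesis \<open>no_divisible\<close> stands for the
  discreteness of the lattice.\<close>

lemma conj_act_eq_0_imp: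
  assumes M: "int_submodule M" "M \<subseteq> K" "\<theta> ` M \<subseteq> M"
    and no_divisible: "\<And>x. x \<in> M \<Longrightarrow> \<forall>k. \<exists>y\<in>M. x = of_nat p ^ k * y \<Longrightarrow> x = 0"
    and \<alpha>: "\<alpha> \<in> M" "\<alpha> \<notin> \<rat>" "Tr p \<theta> \<alpha> \<noteq> 0"
    and f: "conj_act \<theta> f \<alpha> = 0" "degree f < p"
  shows "f = 0"
proof (rule ccontr)
  assume "f \<noteq> 0"
  define \<beta> where "\<beta> = conj_act \<theta> [:-1, 1:] \<alpha>"
  \<comment> \<open>The annihilator of \<beta> in the variable \<open>Y = x - 1\<close>; composition
    with \<open>[:-1, 1:]\<close> returns to \<open>x\<close>, and \<open>[:1, 1:]\<close> below
    goes the other way.\<close>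
  define I where "I = {g. conj_act \<theta> (g \<circ>\<^sub>p [:-1, 1:]) \<beta> = 0}"
  have "\<alpha> \<in> K"
    using M(2) \<alpha>(1) by blast
  have "\<beta> \<in> M"
    unfolding \<beta>_def by (rule conj_act_in_submodule[OF M(1,3) \<alpha>(1)])
  then have "\<beta> \<in> K"
    using M(2) by blast
  have "\<beta> \<noteq> 0"
    using fixed[OF \<open>\<alpha> \<in> K\<close>] \<alpha>(2) by (auto simp: \<beta>_def conj_act_pCons)
  have "Tr p \<theta> (conj_act \<theta> f \<alpha>) = 0"
    by (simp add: f(1) Tr_def funpow_rat)
  then have "poly f 1 = 0"
    using Tr_conj_act[OF \<open>\<alpha> \<in> K\<close>] \<alpha>(3) by simp
  then obtain f' where f': "f = [:-1, 1:] * f'"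
    using poly_eq_0_iff_dvd[of f 1] by auto
  then have "f' \<noteq> 0"
    using \<open>f \<noteq> 0\<close> by auto
  then have "degree f = Suc (degree f')"
    unfolding f' by (subst degree_mult_eq) auto
  define g where "g = f' \<circ>\<^sub>p [:1, 1:]"
  have "g \<circ>\<^sub>p [:-1, 1:] = f'"
    by (simp add: g_def pcompose_assoc[symmetric] pcompose_pCons)
  moreover have "conj_act \<theta> f' \<beta> = 0"
    using f(1) by (simp add: \<beta>_def f' \<open>\<alpha> \<in> K\<close> mult.commute flip: conj_act_mult)
  ultimately have "g \<in> I"
    by (simp add: I_def)
  moreover have "degree g < p - 1"
    using f(2) \<open>degree f = _\<close> by (simp add: g_def degree_pcompose)
  moreover obtain h where h: "[:0, 1:] * ([:0, 1:] ^ (p - 1) + smult (int p) (1 + [:0, 1:] * h)) =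
      [:1, 1:] ^ p - (1 :: int poly)"
    using one_plus_Y_power_prime_eq_eisenstein[OF prime] .
  moreover have "g = 0"
  proof (rule eisenstein_ideal[OF prime, of I])
    show "a + b \<in> I" if "a \<in> I" "b \<in> I" for a b
      using that by (simp add: I_def pcompose_add conj_act_add)
    show "b * a \<in> I" if "a \<in> I" for a b
      using that \<open>\<beta> \<in> K\<close>
      by (simp add: I_def pcompose_mult conj_act_mult) (simp add: conj_act_def funpow_rat)
    show "a \<in> I" if "c \<noteq> 0" "smult c a \<in> I" for c a
      using that by (simp add: I_def pcompose_smult conj_act_smult)
    let ?E = "[:0, 1:] ^ (p - 1) + smult (int p) (1 + [:0, 1:] * h)"
    \<comment> \<open>The factor \<open>x - 1\<close> is supplied by the definition of \<beta>, so
      \<open>?E\<close> acts on \<beta> as \<open>x ^ p - 1\<close> acts on \<alpha>, which is zero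
      by periodicity.\<close>
    have "(?E \<circ>\<^sub>p [:-1, 1:]) * [:-1, 1:] = ([:0, 1:] * ?E) \<circ>\<^sub>p [:-1, 1:]"
      by (simp add: pcompose_mult pcompose_pCons mult.commute)
    also have "\<dots> = [:0, 1:] ^ p - 1"
      unfolding h by (simp add: pcompose_diff pcompose_power pcompose_pCons pcompose_1)
    finally have "conj_act \<theta> (?E \<circ>\<^sub>p [:-1, 1:]) \<beta> = (\<theta> ^^ p) \<alpha> - \<alpha>"
      unfolding \<beta>_def
      by (simp only: conj_act_mult[OF \<open>\<alpha> \<in> K\<close>, symmetric] conj_act_diff conj_act_Y_power conj_act_1)
    then show "?E \<in> I"
      by (simp add: I_def period \<open>\<alpha> \<in> K\<close>)
    show "1 - smult (int p) w \<notin> I" for w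
    proof
      assume "1 - smult (int p) w \<in> I"
      \<comment> \<open>The relation says that \<beta> is \<open>p\<close> times its image under
        \<open>v\<close>; iterating it makes \<beta> divisible by every power of \<open>p\<close>
        inside \<open>M\<close>.\<close>
      define v where "v = w \<circ>\<^sub>p [:-1, 1:]"
      have "\<beta> = of_nat p * conj_act \<theta> v \<beta>"
        using \<open>1 - smult (int p) w \<in> I\<close>
        by (simp add: I_def v_def pcompose_diff pcompose_1 pcompose_smult conj_act_diff conj_act_smult)
      then have "conj_act \<theta> (v ^ k) \<beta> = of_nat p * conj_act \<theta> (v ^ Suc k) \<beta>" for k
        unfolding power_Suc2 conj_act_mult[OF \<open>\<beta> \<in> K\<close>]
        by (metis conj_act_mult conj_act_smult \<open>\<beta> \<in> K\<close> of_int_of_nat_eq mult_smult_left mult_smult_right)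
      then have "\<beta> = of_nat p ^ k * conj_act \<theta> (v ^ k) \<beta>" for k
        by (induction k) (simp, metis mult.assoc power_Suc2)
      moreover have "conj_act \<theta> (v ^ k) \<beta> \<in> M" for k
        by (rule conj_act_in_submodule[OF M(1,3) \<open>\<beta> \<in> M\<close>])
      ultimately show False
        using no_divisible[OF \<open>\<beta> \<in> M\<close>] \<open>\<beta> \<noteq> 0\<close> by blast
    qed
  qed fact+
  ultimately show False
    using \<open>f' \<noteq> 0\<close> pcompose_eq_0[of f' "[:1, 1:]"] by (simp add: g_def)
qed

end

text \<open>Passes from relations of an indexed family to independence of its range; injectivity is
  included so that the range has full cardinality.\<close>

lemma (in vector_space) independent_imageI:
  assumes "finite I" and zero: "\<And>c. (\<Sum>i\<in>I. scale (c i) (v i)) = 0 \<Longrightarrow> \<forall>i\<in>I. c i = 0"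
  shows "inj_on v I" and "independent (v ` I)"
proof -
  show inj: "inj_on v I"
  proof (rule inj_onI, rule ccontr)
    fix i j assume ij: "i \<in> I" "j \<in> I" "v i = v j" "i \<noteq> j"
    \<comment> \<open>If two members coincide, the coefficients 1 and -1 at their indices give a
      nontrivial relation.\<close>
    have "(\<Sum>k\<in>I. scale (of_bool (k = i) - of_bool (k = j)) (v k)) =
        (\<Sum>k\<in>I. (if k = i then v k else 0) - (if k = j then v k else 0))"
      by (intro sum.cong) auto
    also have "\<dots> = 0"
      using ij \<open>finite I\<close> by (simp add: sum_subtractf)
    finally show False
      using zero[of "\<lambda>k. of_bool (k = i) - of_bool (k = j)"] ij by auto
  qed
  show "independent (v ` I)"
  proof (rule independent_if_scalars_zero)
    fix u x assume "(\<Sum>x\<in>v ` I. scale (u x) x) = 0" "x \<in> v ` I"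
    then show "u x = 0"
      using zero[of "\<lambda>i. u (v i)"] by (auto simp: sum.reindex[OF inj])
  qed (use \<open>finite I\<close> in simp)
qed

section \<open>Independence of the conjugates over the rationals, and of their images over the
  reals\<close>

context cyclic_automorphism
begin

lemma conjugates_rat_relation_trivial:
  assumes M: "int_submodule M" "M \<subseteq> K" "\<theta> ` M \<subseteq> M"
    and no_divisible: "\<And>x. x \<in> M \<Longrightarrow> \<forall>k. \<exists>y\<in>M. x = of_nat p ^ k * y \<Longrightarrow> x = 0"
    and \<alpha>: "\<alpha> \<in> M" "\<alpha> \<notin> \<rat>" "Tr p \<theta> \<alpha> \<noteq> 0"
    and u: "(\<Sum>i<p. of_rat (u i) * (\<theta> ^^ i) \<alpha>) = 0"
    and "i < p"
  shows "u i = 0"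
proof -
  obtain D :: int where D: "D > 0" "\<forall>i\<in>{..<p}. of_int D * u i \<in> \<int>"
    using common_denominator[of "{..<p}" u] by auto
  \<comment> \<open>For \<open>i < p\<close> the floor is exact and only converts the integer value
    to type \<open>int\<close>.\<close>
  define d where "d i = \<lfloor>of_int D * u i\<rfloor>" for i
  have d: "of_int (d i) = of_int D * u i" if "i < p" for i
    using D(2) that by (simp add: d_def)
  define f where "f = (\<Sum>i<p. monom (d i) i)"
  have coeff_f: "coeff f i = (if i < p then d i else 0)" for i
    by (simp add: f_def coeff_sum)
  have "p > 0"
    using prime by (rule prime_gt_0_nat)
  have "degree f \<le> p - 1"
    by (rule degree_le) (use coeff_f in auto)
  then have deg: "degree f < p"
    using \<open>p > 0\<close> by linarith
  have "conj_act \<theta> f \<alpha> = (\<Sum>i<p. of_int (d i) * (\<theta> ^^ i) \<alpha>)"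
    by (simp add: conj_act_eq_sum[OF deg] coeff_f)
  also have "\<dots> = (\<Sum>i<p. of_int D * (of_rat (u i) * (\<theta> ^^ i) \<alpha>))"
  proof (rule sum.cong[OF refl])
    fix i assume "i \<in> {..<p}"
    then have "real_of_int (d i) = of_rat (of_int (d i))"
      by simp
    also have "\<dots> = of_int D * of_rat (u i)"
      using \<open>i \<in> {..<p}\<close> by (simp only: d lessThan_iff of_rat_mult of_rat_of_int_eq)
    finally show "of_int (d i) * (\<theta> ^^ i) \<alpha> = of_int D * (of_rat (u i) * (\<theta> ^^ i) \<alpha>)"
      by simp
  qed
  also have "\<dots> = 0"
    using u by (simp flip: sum_distrib_left)
  finally have "f = 0"
    using conj_act_eq_0_imp[OF M no_divisible \<alpha> _ deg] by blast
  then have "d i = 0"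
    using coeff_f[of i] \<open>i < p\<close> by simp
  then show ?thesis
    using d[OF \<open>i < p\<close>] D(1) by simp
qed

text \<open>A dimension count: an element outside the span would give \<open>p + 1\<close>
  independent elements of a space of dimension \<open>p\<close>.\<close>

lemma K_subset_rat_span_conjugates:
  assumes dim: "degree_over_rat K = p"
    and "\<alpha> \<in> K"
    and indep: "\<forall>u. (\<Sum>i<p. of_rat (u i) * (\<theta> ^^ i) \<alpha>) = 0 \<longrightarrow> (\<forall>i<p. u i = 0)"
  shows "K \<subseteq> rat_space.span ((\<lambda>i. (\<theta> ^^ i) \<alpha>) ` {..<p})"
proof
  define B where "B = (\<lambda>i. (\<theta> ^^ i) \<alpha>) ` {..<p}"
  have inj: "inj_on (\<lambda>i. (\<theta> ^^ i) \<alpha>) {..<p}" and indep_B: "rat_space.independent B"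
    unfolding B_def
    by (rule rat_space.independent_imageI; use indep in auto)+
  have "finite B" "card B = p"
    by (simp_all add: B_def card_image[OF inj])
  have "B \<subseteq> K"
    using \<open>\<alpha> \<in> K\<close> by (auto simp: B_def funpow_closed)
  fix x assume "x \<in> K"
  show "x \<in> rat_space.span B"
  proof (rule ccontr)
    assume x: "x \<notin> rat_space.span B"
    then have "x \<notin> B"
      using rat_space.span_base by blast
    have ins: "rat_space.independent (insert x B)"
      using indep_B x by (simp add: rat_space.independent_insert)
    obtain C where C: "C \<subseteq> K" "K \<subseteq> rat_space.span C" "card C = p"
      using rat_space.basis_exists[of K] dim by (metis degree_over_rat_def)
    \<comment> \<open>An infinite set would have cardinality 0, but \<open>p\<close> is
      positive.\<close>
    have "finite C"
      using C(3) prime by (metis card_ge_0_finite prime_gt_0_nat)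
    then have "card (insert x B) \<le> card C"
      using rat_space.independent_span_bound[OF _ ins] \<open>x \<in> K\<close> \<open>B \<subseteq> K\<close> C(2) by blast
    then show False
      using C(3) \<open>x \<notin> B\<close> \<open>finite B\<close> \<open>card B = p\<close> by simp
  qed
qed

text \<open>A relation between the powers of \<theta> that holds at a rational basis of
  \<open>K\<close> holds on all of \<open>K\<close>, where Dedekind's independence applies to real
  coefficients.\<close>

lemma conjugates_real_relation_trivial:
  fixes c :: "nat \<Rightarrow> real"
  assumes dim: "degree_over_rat K = p"
    and "\<alpha> \<in> K"
    and indep: "\<forall>u. (\<Sum>i<p. of_rat (u i) * (\<theta> ^^ i) \<alpha>) = 0 \<longrightarrow> (\<forall>i<p. u i = 0)"
    and c: "\<And>j. j < p \<Longrightarrow> (\<Sum>i<p. c i * (\<theta> ^^ i) ((\<theta> ^^ j) \<alpha>)) = 0"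
    and "i < p"
  shows "c i = 0"
proof -
  have "(\<Sum>i<p. c i * (\<theta> ^^ i) x) = 0" if "x \<in> K" for x
  proof -
    have "x \<in> rat_space.span ((\<lambda>i. (\<theta> ^^ i) \<alpha>) ` {..<p})"
      using K_subset_rat_span_conjugates[OF dim \<open>\<alpha> \<in> K\<close> indep] that by blast
    \<comment> \<open>Membership in \<open>K\<close> is carried along because \<theta> is additive
      and multiplicative only there.\<close>
    then have "x \<in> K \<and> (\<Sum>i<p. c i * (\<theta> ^^ i) x) = 0"
    proof (induction rule: rat_space.span_induct_alt)
      case base
      then show ?case
        by (simp add: K_0 funpow_rat)
    next
      case (step q y z)
      then obtain j where j: "j < p" "y = (\<theta> ^^ j) \<alpha>"
        by auto
      then have "y \<in> K" "(\<Sum>i<p. c i * (\<theta> ^^ i) y) = 0"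
        using c \<open>\<alpha> \<in> K\<close> by (auto simp: funpow_closed)
      moreover have "(\<Sum>i<p. c i * (\<theta> ^^ i) (of_rat q * y + z)) =
          of_rat q * (\<Sum>i<p. c i * (\<theta> ^^ i) y) + (\<Sum>i<p. c i * (\<theta> ^^ i) z)"
        using \<open>y \<in> K\<close> step
        by (simp add: funpow_conj_add funpow_conj_mult funpow_rat K_mult K_of_rat sum.distrib
            sum_distrib_left algebra_simps)
      ultimately show ?case
        using step by (simp add: K_add K_mult K_of_rat)
    qed
    then show ?thesis ..
  qed
  then show ?thesis
    using \<open>i < p\<close>
    by (intro characters_independent[of "{..<p}" K "\<lambda>i. \<theta> ^^ i" c])
      (auto simp: K_1 K_mult funpow_conj_mult funpow_rat distinct)
qed

end

section \<open>The Galois group and the canonical embedding\<close>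

text \<open>Periodicity and distinctness come from the order of the generator, the fixed elements
  from the Galois property.\<close>

lemma cyclic_automorphism_generator:
  assumes "prime p" and K: "cyclic_number_field p K"
    and \<theta>: "\<theta> \<in> carrier (Gal K)" "generate (Gal K) {\<theta>} = carrier (Gal K)"
  shows "cyclic_automorphism p K \<theta>"
proof -
  have sub: "is_subfield K" and fixed_field: "{x \<in> K. \<forall>f\<in>carrier (Gal K). f x = x} = \<rat>"
    and order: "order (Gal K) = p"
    using K by (auto simp: cyclic_number_field_def galois_over_rat_def)
  have "\<rat> \<subseteq> K"
    using fixed_field by blast
  then interpret G: group "Gal K"
    using sub by (intro group_Gal)
  have carrier: "carrier (Gal K) = rat_automorphisms K"
    by (simp add: Gal_def)
  have "p > 0"
    using \<open>prime p\<close> by (rule prime_gt_0_nat)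
  have aut: "\<theta> \<in> Bij K" "\<And>x y. x \<in> K \<Longrightarrow> y \<in> K \<Longrightarrow> \<theta> (x + y) = \<theta> x + \<theta> y"
    "\<And>x y. x \<in> K \<Longrightarrow> y \<in> K \<Longrightarrow> \<theta> (x * y) = \<theta> x * \<theta> y" "\<And>q. q \<in> \<rat> \<Longrightarrow> \<theta> q = q"
    using \<theta>(1) by (auto simp: carrier rat_automorphisms_def)
  have closed: "\<theta> x \<in> K" if "x \<in> K" for x
    using Bij_imp_funcset[OF aut(1)] that by blast
  have mult_Gal: "f \<otimes>\<^bsub>Gal K\<^esub> g = compose K f g" if "f \<in> Bij K" "g \<in> Bij K" for f g
    using that by (simp add: Gal_def BijGroup_def)
  have one_Gal: "\<one>\<^bsub>Gal K\<^esub> x = x" if "x \<in> K" for x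
    using that by (simp add: Gal_def BijGroup_def)
  have pow: "(\<theta> [^]\<^bsub>Gal K\<^esub> n) x = (\<theta> ^^ n) x" if "x \<in> K" for n :: nat and x
    using that
  proof (induction n arbitrary: x)
    case 0
    then show ?case
      by (simp add: one_Gal)
  next
    case (Suc n)
    have "\<theta> [^]\<^bsub>Gal K\<^esub> n \<in> Bij K"
      using G.nat_pow_closed[OF \<theta>(1), of n] by (simp add: carrier rat_automorphisms_def)
    then have "(\<theta> [^]\<^bsub>Gal K\<^esub> Suc n) x = (\<theta> [^]\<^bsub>Gal K\<^esub> n) (\<theta> x)"
      using aut(1) Suc.prems by (simp add: mult_Gal compose_eq)
    then show ?case
      using Suc by (simp add: closed funpow_swap1)
  qed
  have fin: "finite (carrier (Gal K))"
    using order \<open>p > 0\<close> by (metis order_def card_ge_0_finite)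
  have ord: "G.ord \<theta> = p"
    using G.generate_pow_card[OF \<theta>(1)] order by (simp add: \<theta>(2) order_def)
  show ?thesis
  proof
    show "(\<theta> ^^ p) x = x" if "x \<in> K" for x
      using G.pow_order_eq_1[OF \<theta>(1)] pow[OF that, of p] one_Gal[OF that]
      by (simp add: order)
    show "\<exists>x\<in>K. (\<theta> ^^ i) x \<noteq> (\<theta> ^^ j) x" if "i < p" "j < p" "i \<noteq> j" for i j
    proof (rule ccontr)
      assume "\<not> ?thesis"
      then have eq: "(\<theta> [^]\<^bsub>Gal K\<^esub> i) x = (\<theta> [^]\<^bsub>Gal K\<^esub> j) x" if "x \<in> K" for x
        using that by (simp add: pow)
      \<comment> \<open>Both powers are \<open>undefined\<close> outside \<open>K\<close>, so
        agreement on \<open>K\<close> makes them equal in the group.\<close>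
      have "\<theta> [^]\<^bsub>Gal K\<^esub> k \<in> extensional K" for k :: nat
        using G.nat_pow_closed[OF \<theta>(1), of k] by (simp add: carrier rat_automorphisms_def Bij_def)
      then have "\<theta> [^]\<^bsub>Gal K\<^esub> i = \<theta> [^]\<^bsub>Gal K\<^esub> j"
        using eq by (intro extensionalityI)
      then have "i = j"
        using G.ord_inj[OF \<theta>(1)] that by (auto simp: ord dest: inj_onD)
      then show False
        using \<open>i \<noteq> j\<close> by simp
    qed
    show "x \<in> \<rat>" if x: "x \<in> K" "\<theta> x = x" for x
    proof -
      \<comment> \<open>In a finite group every element generated by \<theta> is a natural power of
        it, so a fixed point of \<theta> is fixed by the whole group.\<close>
      have "(\<theta> ^^ n) x = x" for n
        by (induction n) (simp_all add: x)
      then have "f x = x" if "f \<in> carrier (Gal K)" for f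
        using that x(1) unfolding \<theta>(2)[symmetric] G.generate_pow_on_finite_carrier[OF fin \<theta>(1)]
        by (auto simp: pow)
      then show ?thesis
        using x(1) fixed_field by blast
    qed
  qed (use \<open>prime p\<close> sub \<open>\<rat> \<subseteq> K\<close> aut closed in auto)
qed

section \<open>Coordinates, norms and shortest vectors under the canonical embedding\<close>

lemma bij_betw_card_lessThan:
  "bij_betw (\<lambda>j::'n::{finite,linorder}. card {..<j}) UNIV {..<CARD('n)}"
proof -
  \<comment> \<open>Counting predecessors is strictly monotone, hence injective; equal cardinalities
    then give surjectivity.\<close>
  have less: "card {..<j} < card {..<k}" if "j < k" for j k :: 'n
    by (rule psubset_card_mono) (use that in auto)
  have inj: "inj (\<lambda>j::'n. card {..<j})"
    by (rule linorder_injI) (use less in force)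
  have "card {..<j} < CARD('n)" for j :: 'n
    by (rule psubset_card_mono) auto
  then have "range (\<lambda>j::'n. card {..<j}) \<subseteq> {..<CARD('n)}"
    by auto
  then have "range (\<lambda>j::'n. card {..<j}) = {..<CARD('n)}"
    by (intro card_subset_eq) (simp_all add: card_image[OF inj])
  with inj show ?thesis
    by (simp add: bij_betw_def)
qed

lemma funpow_commute: "(f ^^ m) ((f ^^ n) x) = (f ^^ n) ((f ^^ m) x)"
  by (metis add.commute comp_apply funpow_add)

lemma canonical_embedding_nth:
  "canonical_embedding \<theta> x $ j = (\<theta> ^^ card {..<j}) x"
  by (simp add: canonical_embedding_def)

lemma norm_canonical_embedding_sq:
  "(norm (canonical_embedding \<theta> x :: real ^ 'n::{finite,linorder}))\<^sup>2 =
    (\<Sum>i<CARD('n). ((\<theta> ^^ i) x)\<^sup>2)"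
proof -
  have "(norm (canonical_embedding \<theta> x :: real ^ 'n::{finite,linorder}))\<^sup>2 =
      (\<Sum>j\<in>(UNIV :: 'n set). ((\<theta> ^^ card {..<j}) x)\<^sup>2)"
    by (simp add: norm_vec_def L2_set_def sum_nonneg canonical_embedding_nth)
  also have "\<dots> = (\<Sum>i<CARD('n). ((\<theta> ^^ i) x)\<^sup>2)"
    by (rule sum.reindex_bij_betw[OF bij_betw_card_lessThan])
  finally show ?thesis .
qed

lemma canonical_embedding_eq_0_imp:
  assumes "canonical_embedding \<theta> x = (0 :: real ^ 'n::{finite,linorder})"
  shows "x = 0"
proof -
  have "(\<Sum>i<CARD('n). ((\<theta> ^^ i) x)\<^sup>2) = 0"
    using norm_canonical_embedding_sq[of \<theta> x, where 'n = 'n] assms by simp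
  then have "\<forall>i\<in>{..<CARD('n)}. ((\<theta> ^^ i) x)\<^sup>2 = 0"
    by (subst (asm) sum_nonneg_eq_0_iff) auto
  \<comment> \<open>The coordinate with number 0 is \<open>x\<close> itself.\<close>
  then have "((\<theta> ^^ 0) x)\<^sup>2 = 0"
    by (metis lessThan_iff zero_less_card_finite)
  then show ?thesis
    by simp
qed

lemma int_span_subset_span: "int_span B \<subseteq> span B"
  unfolding int_span_def
  by (rule int_module.span_minimal)
    (auto simp: int_module.subspace_def span_superset span_zero span_add span_scale)

lemma int_span_subset: "B \<subseteq> M \<Longrightarrow> int_submodule M \<Longrightarrow> int_span B \<subseteq> M"
  unfolding int_span_def int_submodule_def by (rule int_module.span_minimal)

text \<open>A least element need not exist among reals; the shortest vector provides one for
  \<open>LEAST\<close>.\<close>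

lemma sq_minimum_eq:
  assumes "shortest_nonzero_in u L"
  shows "sq_minimum L = (norm u)\<^sup>2"
  unfolding sq_minimum_def
  by (rule Least_equality) (use assms in \<open>auto simp: shortest_nonzero_in_def\<close>)

context cyclic_automorphism
begin

lemma canonical_embedding_add:
  "x \<in> K \<Longrightarrow> y \<in> K \<Longrightarrow>
    canonical_embedding \<theta> (x + y) = canonical_embedding \<theta> x + canonical_embedding \<theta> y"
  by (simp add: vec_eq_iff canonical_embedding_nth funpow_conj_add)

lemma canonical_embedding_scale:
  "x \<in> K \<Longrightarrow> canonical_embedding \<theta> (of_int k * x) = of_int k *\<^sub>R canonical_embedding \<theta> x"
  by (simp add: vec_eq_iff canonical_embedding_nth funpow_conj_mult funpow_rat K_of_int)

lemma int_submodule_canonical_embedding: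
  assumes "int_submodule M" "M \<subseteq> K"
  shows "int_submodule (canonical_embedding \<theta> ` M)"
  unfolding int_submodule_iff
proof (intro conjI ballI allI)
  have "canonical_embedding \<theta> 0 = 0"
    by (simp add: vec_eq_iff canonical_embedding_nth funpow_rat)
  then show "0 \<in> canonical_embedding \<theta> ` M"
    using assms(1) unfolding int_submodule_iff by (metis image_eqI)
qed (use assms in \<open>auto simp: int_submodule_iff subset_iff
    simp flip: canonical_embedding_add canonical_embedding_scale\<close>)

text \<open>With exactly \<open>p\<close> coordinates, \<theta> shifts them cyclically and preserves
  the sum of squares.\<close>

lemma norm_canonical_embedding_funpow:
  assumes "CARD('n::{finite,linorder}) = p" "x \<in> K"
  shows "norm (canonical_embedding \<theta> ((\<theta> ^^ i) x) :: real ^ 'n::{finite,linorder}) =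
    norm (canonical_embedding \<theta> x :: real ^ 'n::{finite,linorder})"
proof (induction i)
  case (Suc i)
  have "(norm (canonical_embedding \<theta> (\<theta> ((\<theta> ^^ i) x)) :: real ^ 'n::{finite,linorder}))\<^sup>2 =
      (norm (canonical_embedding \<theta> ((\<theta> ^^ i) x) :: real ^ 'n::{finite,linorder}))\<^sup>2"
    unfolding norm_canonical_embedding_sq assms(1)
    by (rule sum_conj_shift) (rule funpow_closed[OF assms(2)])
  then show ?case
    using Suc by simp
qed simp

text \<open>Dividing a nonzero \<open>x\<close> by a high power of \<open>p\<close> would yield a
  nonzero lattice vector shorter than \<open>u\<close>.\<close>

lemma divisible_eq_0:
  assumes "M \<subseteq> K"
    and short: "shortest_nonzero_in u (canonical_embedding \<theta> ` M :: (real ^ 'n::{finite,linorder}) set)"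
    and x: "x \<in> M" "\<forall>k. \<exists>y\<in>M. x = of_nat p ^ k * y"
  shows "x = 0"
proof (rule ccontr)
  assume "x \<noteq> 0"
  let ?\<sigma> = "canonical_embedding \<theta> :: real \<Rightarrow> real ^ 'n::{finite,linorder}"
  have u: "norm u > 0" "\<And>y. y \<in> M \<Longrightarrow> y \<noteq> 0 \<Longrightarrow> norm u \<le> norm (?\<sigma> y)"
    using short canonical_embedding_eq_0_imp by (auto simp: shortest_nonzero_in_def)
  have "real p > 1"
    using prime prime_gt_1_nat by auto
  then obtain k where k: "norm (?\<sigma> x) / norm u < real p ^ k"
    using real_arch_pow by blast
  obtain y where y: "y \<in> M" "x = of_int (int p ^ k) * y"
    using x(2) by force
  then have "y \<noteq> 0"
    using \<open>x \<noteq> 0\<close> by auto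
  have "?\<sigma> x = of_int (int p ^ k) *\<^sub>R ?\<sigma> y"
    unfolding y(2) by (rule canonical_embedding_scale) (use y(1) assms(1) in blast)
  then have "norm (?\<sigma> x) = real p ^ k * norm (?\<sigma> y)"
    by simp
  also have "\<dots> \<ge> real p ^ k * norm u"
    using u(2)[OF y(1) \<open>y \<noteq> 0\<close>] by (intro mult_left_mono) auto
  finally show False
    using k u(1) by (simp add: field_simps)
qed

lemma Tr_funpow: "x \<in> K \<Longrightarrow> Tr p \<theta> ((\<theta> ^^ i) x) = Tr p \<theta> x"
  by (induction i) (simp_all add: Tr_conj funpow_closed)

text \<open>Each coordinate of the sum is the trace of some conjugate of \<open>x\<close>, hence the
  trace of \<open>x\<close>.\<close>

lemma sum_canonical_embedding_conjugates:
  assumes "x \<in> K" "Tr p \<theta> x = 0"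
  shows "(\<Sum>i<p. canonical_embedding \<theta> ((\<theta> ^^ i) x)) = 0"
proof -
  have "(\<Sum>i<p. (\<theta> ^^ k) ((\<theta> ^^ i) x)) = Tr p \<theta> ((\<theta> ^^ k) x)" for k
    unfolding Tr_def by (rule sum.cong[OF refl funpow_commute])
  then show ?thesis
    using assms by (simp add: vec_eq_iff canonical_embedding_nth Tr_funpow)
qed

end

section \<open>The trace criterion for the span of the conjugate vectors\<close>

theorem corollary3p3:
  fixes p :: nat
    and K :: "real set"
    and \<theta> :: "real \<Rightarrow> real"
    and \<sigma> :: "real \<Rightarrow> real ^ 'n::{finite,linorder}"
    and M :: "real set"
    and \<alpha> :: real
  assumes "prime p" and "p > 2" and "CARD('n) = p"
    and "cyclic_number_field p K"
    and "\<theta> \<in> carrier (Gal K)" and "generate (Gal K) {\<theta>} = carrier (Gal K)"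
    and "\<sigma> = canonical_embedding \<theta>"
    and "int_submodule M" and "M \<subseteq> ring_of_integers K" and "\<theta> ` M \<subseteq> M"
    and "\<alpha> \<in> M - \<int>"
    and "shortest_nonzero_in (\<sigma> \<alpha>) (\<sigma> ` M)"
  shows "Tr p \<theta> \<alpha> \<noteq> 0 \<longleftrightarrow>
    (let L = int_span {\<sigma> ((\<theta> ^^ i) \<alpha>) | i. i < p}
     in L \<subseteq> \<sigma> ` M \<and> lattice_of_rank p L \<and> well_rounded L)"
proof -
  interpret cyclic_automorphism p K \<theta>
    by (rule cyclic_automorphism_generator) fact+
  note short = \<open>shortest_nonzero_in (\<sigma> \<alpha>) (\<sigma> ` M)\<close>
  have "M \<subseteq> K" and dim: "degree_over_rat K = p"
    using assms(4,9) by (auto simp: ring_of_integers_def cyclic_number_field_def)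
  have "\<alpha> \<in> M" "\<alpha> \<in> K"
    using assms(11) \<open>M \<subseteq> K\<close> by auto
  \<comment> \<open>A rational algebraic integer is an integer.\<close>
  have "\<alpha> \<notin> \<rat>"
    using assms(9,11) rational_algebraic_int_is_int by (auto simp: ring_of_integers_def)
  define v where "v i = \<sigma> ((\<theta> ^^ i) \<alpha>)" for i
  define L where "L = int_span (v ` {..<p})"
  have L_eq: "int_span {\<sigma> ((\<theta> ^^ i) \<alpha>) | i. i < p} = L"
    unfolding L_def v_def by (rule arg_cong[where f = int_span]) auto
  have conj_M: "(\<theta> ^^ i) \<alpha> \<in> M" for i
    by (induction i) (use \<open>\<alpha> \<in> M\<close> assms(10) in auto)
  have "L \<subseteq> \<sigma> ` M"
    unfolding L_def
  proof (rule int_span_subset)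
    show "v ` {..<p} \<subseteq> \<sigma> ` M"
      using conj_M by (auto simp: v_def)
    show "int_submodule (\<sigma> ` M)"
      unfolding assms(7) by (rule int_submodule_canonical_embedding) fact+
  qed
  have v_L: "v i \<in> L" if "i < p" for i
    unfolding L_def int_span_def using that by (intro int_module.span_base) auto
  have "p > 0"
    using \<open>p > 2\<close> by simp
  have "Tr p \<theta> \<alpha> \<noteq> 0 \<longleftrightarrow> L \<subseteq> \<sigma> ` M \<and> lattice_of_rank p L \<and> well_rounded L"
  proof
    assume Tr: "Tr p \<theta> \<alpha> \<noteq> 0"
    have relation: "\<forall>i\<in>{..<p}. c i = 0" if c: "(\<Sum>i<p. c i *\<^sub>R v i) = 0" for c
    proof
      fix i assume "i \<in> {..<p}"
      show "c i = 0"
      proof (rule conjugates_real_relation_trivial[OF dim \<open>\<alpha> \<in> K\<close>])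
        show "\<forall>u. (\<Sum>i<p. of_rat (u i) * (\<theta> ^^ i) \<alpha>) = 0 \<longrightarrow> (\<forall>i<p. u i = 0)"
          using conjugates_rat_relation_trivial[OF assms(8) \<open>M \<subseteq> K\<close> assms(10) _
              \<open>\<alpha> \<in> M\<close> \<open>\<alpha> \<notin> \<rat>\<close> Tr]
            divisible_eq_0[OF \<open>M \<subseteq> K\<close> short[unfolded assms(7)]] by blast
        show "(\<Sum>i<p. c i * (\<theta> ^^ i) ((\<theta> ^^ j) \<alpha>)) = 0" if "j < p" for j
        proof -
          \<comment> \<open>Every \<open>j < p\<close> numbers a coordinate; reading the vector
            relation there and commuting the powers of \<theta> gives the relation at the
            \<open>j\<close>-th conjugate.\<close>
          have "j \<in> range (\<lambda>k::'n. card {..<k})"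
            using bij_betw_card_lessThan[where 'n = 'n] that \<open>CARD('n) = p\<close>
            by (simp add: bij_betw_def)
          then obtain k :: 'n where k: "card {..<k} = j"
            by blast
          have "(\<Sum>i<p. c i *\<^sub>R v i) $ k = 0"
            using c by simp
          then have "(\<Sum>i<p. c i * (\<theta> ^^ j) ((\<theta> ^^ i) \<alpha>)) = 0"
            by (simp add: v_def assms(7) canonical_embedding_nth k)
          moreover have "(\<theta> ^^ j) ((\<theta> ^^ i) \<alpha>) = (\<theta> ^^ i) ((\<theta> ^^ j) \<alpha>)" for i
            by (rule funpow_commute)
          ultimately show ?thesis
            by simp
        qed
      qed (use \<open>i \<in> {..<p}\<close> in simp)
    qed
    have inj: "inj_on v {..<p}" and indep: "independent (v ` {..<p})"
      using real_vector.independent_imageI[of "{..<p}" v] relation by auto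
    have card: "card (v ` {..<p}) = p"
      by (simp add: card_image[OF inj])
    have "lattice_of_rank p L"
      unfolding lattice_of_rank_def using indep card L_def by blast
    moreover have "v ` {..<p} \<subseteq> minimal_vectors L"
    proof -
      \<comment> \<open>A shortest vector of the large lattice that lies in the sublattice is
        shortest there too.\<close>
      have "\<sigma> \<alpha> \<in> L"
        using v_L[OF \<open>p > 0\<close>] by (simp add: v_def)
      then have "shortest_nonzero_in (\<sigma> \<alpha>) L"
        using short \<open>L \<subseteq> \<sigma> ` M\<close> by (auto simp: shortest_nonzero_in_def)
      then have "sq_minimum L = (norm (\<sigma> \<alpha>))\<^sup>2"
        by (rule sq_minimum_eq)
      moreover have "norm (v i) = norm (\<sigma> \<alpha>)" for i
        unfolding v_def assms(7)
        by (rule norm_canonical_embedding_funpow) fact+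
      ultimately show ?thesis
        using v_L by (auto simp: minimal_vectors_def)
    qed
    ultimately show "L \<subseteq> \<sigma> ` M \<and> lattice_of_rank p L \<and> well_rounded L"
      using \<open>L \<subseteq> \<sigma> ` M\<close> indep card assms(3) by (auto simp: well_rounded_def)
  next
    assume "L \<subseteq> \<sigma> ` M \<and> lattice_of_rank p L \<and> well_rounded L"
    then obtain S where S: "S \<subseteq> L" "independent S" "card S = p"
      using assms(3) by (auto simp: well_rounded_def minimal_vectors_def)
    show "Tr p \<theta> \<alpha> \<noteq> 0"
    proof
      assume "Tr p \<theta> \<alpha> = 0"
      then have "(\<Sum>i<p. v i) = 0"
        unfolding v_def assms(7) by (rule sum_canonical_embedding_conjugates[OF \<open>\<alpha> \<in> K\<close>])
      moreover have "{..<p} = insert 0 {1..<p}"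
        using \<open>p > 0\<close> by auto
      \<comment> \<open>With trace zero, \<open>v 0\<close> depends on the other conjugate vectors,
        so \<open>L\<close> lies in the span of at most \<open>p - 1\<close> vectors and cannot
        contain the \<open>p\<close> independent vectors of \<open>S\<close>.\<close>
      ultimately have v0: "v 0 = - (\<Sum>i\<in>{1..<p}. v i)"
        by (simp add: eq_neg_iff_add_eq_0)
      have "v ` {..<p} \<subseteq> span (v ` {1..<p})"
        unfolding \<open>{..<p} = _\<close> image_insert v0
        by (auto intro!: span_neg span_sum intro: span_base)
      then have "span (v ` {..<p}) \<subseteq> span (v ` {1..<p})"
        by (simp add: span_minimal)
      then have "S \<subseteq> span (v ` {1..<p})"
        using S(1) int_span_subset_span unfolding L_def by blast
      then have "card S \<le> card (v ` {1..<p})"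
        using independent_span_bound[OF _ S(2)] by blast
      also have "\<dots> \<le> p - 1"
        using card_image_le[of "{1..<p}" v] by simp
      finally show False
        using S(3) \<open>p > 0\<close> by simp
    qed
  qed
  then show ?thesis
    by (simp add: L_eq)
qed

end
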